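(* Let $\ell\in\mathbb N$ and $\chi,a,s\in\mathbb C$ with $s\neq0$. The linear system $$Y'=\left(\frac1{z^2}\begin{pmatrix}-\frac s2 & -s\chi \\ 0 & 0\end{pmatrix}+\frac1z\begin{pmatrix}\ell-\chi a & -\frac{a}2\\ \frac{a}2 & \chi a\end{pmatrix}+\begin{pmatrix} 0 & 0 \\ s\chi & \frac s2\end{pmatrix}\right)Y$$ has a vector polynomial solution if and only if $$\mathcal P_{\ell,\pm}(\chi,a,s):=\det(G_{1,\ell}\pm G_{2,\ell})=0\quad\text{for some choice of sign }\pm.$$
   Context: $\mathbb N=\{1,2,3,\dots\}$. A vector polynomial solution is a solution $Y(z)=(Y_1(z),Y_2(z))$, not identically zero, both of whose components are polynomials in $z$. $G_{1,\ell}$ and $G_{2,\ell}$ are the following $(\ell+1)\times(\ell+1)$-matrices depending on $(\chi,a,s)$: $$G_{1,\ell}=\begin{pmatrix}\frac s2 & \chi a-1 & 0 & \dots & 0 & 0\\ 0 & \frac s2 & \chi a-2 & \dots & 0 & 0\\ \dots & \dots & \dots & \dots &\dots & \dots\\ 0 & 0 & 0 & \dots & \frac s2 & \chi a-\ell\\ 0 & 0 & 0 & \dots & 0 & \frac 12\end{pmatrix},\qquad G_{2,\ell}=\begin{pmatrix} 0 & 0 &\dots & 0 & \frac a2 & \chi s\\ 0 & 0 &\dots & \frac a2 & \chi s & 0\\ \dots & \dots & \dots &\dots &\dots &\dots\\ \frac a2 & \chi s & \dots & 0 & 0 & 0\\ \chi & 0 & \dots & 0 & 0 & 0\end{pmatrix}.$$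 That is, for $1\le j\le \ell$: $(G_{1,\ell})_{j,j}=\frac s2$, $(G_{1,\ell})_{j,j+1}=\chi a-j$, $(G_{2,\ell})_{j,\ell+1-j}=\frac a2$, $(G_{2,\ell})_{j,\ell+2-j}=\chi s$; $(G_{1,\ell})_{\ell+1,\ell+1}=\frac12$, $(G_{2,\ell})_{\ell+1,1}=\chi$; all other entries are zero. *)

theory Defs
  imports Complex_Main "HOL-Computational_Algebra.Polynomial" "Jordan_Normal_Form.Determinant"
begin

definition system_mat :: "nat \<Rightarrow> complex \<Rightarrow> complex \<Rightarrow> complex \<Rightarrow> complex \<Rightarrow> complex mat" where
  "system_mat l \<chi> a s z =
     (1 / z^2) \<cdot>\<^sub>m mat_of_rows_list 2 [[- (s / 2), - (s * \<chi>)],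
                                   [0, 0]]
     + (1 / z) \<cdot>\<^sub>m mat_of_rows_list 2 [[of_nat l - \<chi> * a, - (a / 2)],
                                   [a / 2, \<chi> * a]]
     + mat_of_rows_list 2 [[0, 0],
                           [s * \<chi>, s / 2]]"

(* The coefficient matrix has a pole at z = 0, so the equation is imposed on the
   punctured plane only; the derivative is taken componentwise. *)
definition is_solution ::
  "nat \<Rightarrow> complex \<Rightarrow> complex \<Rightarrow> complex \<Rightarrow> (complex \<Rightarrow> complex vec) \<Rightarrow> bool" where
  "is_solution l \<chi> a s Y \<longleftrightarrow>
     (\<forall>z. Y z \<in> carrier_vec 2) \<and>
     (\<forall>z. z \<noteq> 0 \<longrightarrow> (\<forall>i<2.
        ((\<lambda>w. Y w $ i) has_field_derivative (system_mat l \<chi> a s z *\<^sub>v Y z) $ i) (at z)))"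

definition is_vector_polynomial_solution ::
  "nat \<Rightarrow> complex \<Rightarrow> complex \<Rightarrow> complex \<Rightarrow> (complex \<Rightarrow> complex vec) \<Rightarrow> bool" where
  "is_vector_polynomial_solution l \<chi> a s Y \<longleftrightarrow>
     is_solution l \<chi> a s Y \<and>
     (\<exists>z. Y z \<noteq> 0\<^sub>v 2) \<and>
     (\<forall>i<2. \<exists>p :: complex poly. \<forall>z. Y z $ i = poly p z)"

(* Rows j and columns k in the entry functions are numbered from 1 to l + 1;
   the library's matrices are indexed from 0, hence the shifts by Suc. *)
definition G1_entry :: "nat \<Rightarrow> complex \<Rightarrow> complex \<Rightarrow> complex \<Rightarrow> nat \<Rightarrow> nat \<Rightarrow> complex" where
  "G1_entry l \<chi> a s j k =
     (if j \<le> l then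
        (if k = j then s / 2
         else if k = j + 1 then \<chi> * a - of_nat j
         else 0)
      else if k = l + 1 then 1 / 2 else 0)"

definition G2_entry :: "nat \<Rightarrow> complex \<Rightarrow> complex \<Rightarrow> complex \<Rightarrow> nat \<Rightarrow> nat \<Rightarrow> complex" where
  "G2_entry l \<chi> a s j k =
     (if j \<le> l then
        (if k = l + 1 - j then a / 2
         else if k = l + 2 - j then \<chi> * s
         else 0)
      else if k = 1 then \<chi> else 0)"

definition G1 :: "nat \<Rightarrow> complex \<Rightarrow> complex \<Rightarrow> complex \<Rightarrow> complex mat" where
  "G1 l \<chi> a s = mat (l + 1) (l + 1) (\<lambda>(i, j). G1_entry l \<chi> a s (Suc i) (Suc j))"

definition G2 :: "nat \<Rightarrow> complex \<Rightarrow> complex \<Rightarrow> complex \<Rightarrow> complex mat" where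
  "G2 l \<chi> a s = mat (l + 1) (l + 1) (\<lambda>(i, j). G2_entry l \<chi> a s (Suc i) (Suc j))"

definition P_plus :: "nat \<Rightarrow> complex \<Rightarrow> complex \<Rightarrow> complex \<Rightarrow> complex" where
  "P_plus l \<chi> a s = det (G1 l \<chi> a s + G2 l \<chi> a s)"

definition P_minus :: "nat \<Rightarrow> complex \<Rightarrow> complex \<Rightarrow> complex \<Rightarrow> complex" where
  "P_minus l \<chi> a s = det (G1 l \<chi> a s - G2 l \<chi> a s)"

end

theory Submission
  imports Defs
begin

text \<open>
  Write \<open>p\<^sub>k\<close>, \<open>q\<^sub>k\<close> for the coefficients of the two components of a polynomial solution. The
  top-degree coefficients of the system force the degree to be \<open>l\<close>, and the recurrences for
  the coefficients are then invariant under the exchange \<open>p\<^sub>k \<leftrightarrow> q\<^sub>l\<^sub>-\<^sub>k\<close>. So every solution splits into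
  a symmetric and an antisymmetric part, and the vectors \<open>q\<^sub>i \<plusminus> p\<^sub>l\<^sub>-\<^sub>i\<close> (\<open>0 \<le> i \<le> l\<close>) are exactly the
  kernel vectors of the matrices \<open>G\<^sub>1 \<plusminus> G\<^sub>2\<close>.
\<close>

section \<open>Algebraic forms of the differential system\<close>

text \<open>The rows of the system multiplied by \<open>z^2\<close> and by \<open>z\<close>
  respectively. This clears the pole, so each row becomes an identity of polynomials;
  \<open>pCons 0\<close> is multiplication by \<open>z\<close>.\<close>

definition poly_system :: "nat \<Rightarrow> complex \<Rightarrow> complex \<Rightarrow> complex \<Rightarrow> complex poly \<Rightarrow> complex poly \<Rightarrow> bool" where
  "poly_system l \<chi> a s p q \<longleftrightarrow>
     pCons 0 (pCons 0 (pderiv p)) =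
       pCons 0 (smult (of_nat l - \<chi> * a) p - smult (a / 2) q) - smult (s / 2) p - smult (s * \<chi>) q \<and>
     pCons 0 (pderiv q) =
       pCons 0 (smult (s * \<chi>) p + smult (s / 2) q) + smult (a / 2) p + smult (\<chi> * a) q"

text \<open>The rows of \<open>(G1 + \<sigma> G2) v = 0\<close> with indices starting at 0. Taking
  \<open>v\<close> as a function on the naturals lets the reflection of indices \<open>i\<close> to
  \<open>l - i\<close> be written without dimension conditions; only the values up to
  \<open>l\<close> matter. The last row continues the pattern of the others with out-of-range
  entries set to 0 and a factor \<open>s\<close> cancelled.\<close>

definition kernel_eqs :: "complex \<Rightarrow> nat \<Rightarrow> complex \<Rightarrow> complex \<Rightarrow> complex \<Rightarrow> (nat \<Rightarrow> complex) \<Rightarrow> bool" where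
  "kernel_eqs \<sigma> l \<chi> a s v \<longleftrightarrow>
     (\<forall>i<l. s / 2 * v i + (\<chi> * a - of_nat (Suc i)) * v (Suc i)
            + \<sigma> * (a / 2 * v (l - Suc i) + \<chi> * s * v (l - i)) = 0) \<and>
     v l / 2 + \<sigma> * \<chi> * v 0 = 0"

section \<open>From the differential equation to polynomial identities\<close>

lemma system_mat_mult_vec:
  assumes "y \<in> carrier_vec 2"
  shows "(system_mat l \<chi> a s z *\<^sub>v y) $ 0 =
           (- (s / 2) * y $ 0 - s * \<chi> * y $ 1) / z^2
             + ((of_nat l - \<chi> * a) * y $ 0 - a / 2 * y $ 1) / z"
    and "(system_mat l \<chi> a s z *\<^sub>v y) $ 1 =
           (a / 2 * y $ 0 + \<chi> * a * y $ 1) / z + s * \<chi> * y $ 0 + s / 2 * y $ 1"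
  using assms
  by (simp_all add: system_mat_def mat_of_rows_list_def scalar_prod_def algebra_simps
      add_divide_distrib diff_divide_distrib numeral_2_eq_2)

text \<open>After multiplication by \<open>z\<close> the values at 0 agree as well, and the factor
  \<open>z\<close> can be cancelled again.\<close>

lemma poly_eqI_punctured:
  fixes p q :: "complex poly"
  assumes "\<And>z. z \<noteq> 0 \<Longrightarrow> poly p z = poly q z"
  shows "p = q"
proof -
  have "poly (pCons 0 p) z = poly (pCons 0 q) z" for z
    using assms by (cases "z = 0") auto
  then have "pCons 0 p = pCons 0 q"
    by (simp only: poly_eq_poly_eq_iff[symmetric] fun_eq_iff) simp
  then show ?thesis by simp
qed

text \<open>Clearing denominators is reversible at each \<open>z \<noteq> 0\<close>, and polynomials
  that agree off 0 are equal.\<close>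

lemma poly_system_iff_ode:
  "poly_system l \<chi> a s p q \<longleftrightarrow>
     (\<forall>z. z \<noteq> 0 \<longrightarrow>
        poly (pderiv p) z = (- (s / 2) * poly p z - s * \<chi> * poly q z) / z^2
             + ((of_nat l - \<chi> * a) * poly p z - a / 2 * poly q z) / z \<and>
        poly (pderiv q) z = (a / 2 * poly p z + \<chi> * a * poly q z) / z
             + s * \<chi> * poly p z + s / 2 * poly q z)"
    (is "_ \<longleftrightarrow> (\<forall>z. z \<noteq> 0 \<longrightarrow> ?A z \<and> ?B z)")
proof -
  let ?A' = "\<lambda>z. poly (pCons 0 (pCons 0 (pderiv p))) z = poly (
       pCons 0 (smult (of_nat l - \<chi> * a) p - smult (a / 2) q) - smult (s / 2) p - smult (s * \<chi>) q) z"
  let ?B' = "\<lambda>z. poly (pCons 0 (pderiv q)) z = poly (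
       pCons 0 (smult (s * \<chi>) p + smult (s / 2) q) + smult (a / 2) p + smult (\<chi> * a) q) z"
  have "poly_system l \<chi> a s p q \<longleftrightarrow> (\<forall>z. z \<noteq> 0 \<longrightarrow> ?A' z \<and> ?B' z)"
    unfolding poly_system_def by (metis poly_eqI_punctured)
  moreover have "?A z \<longleftrightarrow> ?A' z" "?B z \<longleftrightarrow> ?B' z" if "z \<noteq> 0" for z
  proof -
    have e1: "x = u / z^2 + w / z \<longleftrightarrow> z * (z * x) = u + z * w" for x u w
      using that by (simp add: field_simps power2_eq_square)
    show "?A z \<longleftrightarrow> ?A' z" by (simp only: e1, simp add: algebra_simps)
    have e2: "x = u / z + v + w \<longleftrightarrow> z * x = u + z * (v + w)" for x u v w
      using that by (simp add: field_simps)
    show "?B z \<longleftrightarrow> ?B' z" by (simp only: e2, simp add: algebra_simps)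
  qed
  ultimately show ?thesis by blast
qed

lemma ex_vector_polynomial_solution_iff:
  "(\<exists>Y. is_vector_polynomial_solution l \<chi> a s Y) \<longleftrightarrow>
     (\<exists>p q. poly_system l \<chi> a s p q \<and> (p \<noteq> 0 \<or> q \<noteq> 0))"
proof
  assume "\<exists>Y. is_vector_polynomial_solution l \<chi> a s Y"
  then obtain Y where Y: "is_vector_polynomial_solution l \<chi> a s Y" by blast
  then obtain p q where p: "\<And>z. Y z $ 0 = poly p z" and q: "\<And>z. Y z $ 1 = poly q z"
    unfolding is_vector_polynomial_solution_def by (metis one_less_numeral_iff pos2 semiring_norm(76))
  have carr: "Y z \<in> carrier_vec 2" for z
    using Y by (auto simp: is_vector_polynomial_solution_def is_solution_def)
  have D: "((\<lambda>w. Y w $ i) has_field_derivative (system_mat l \<chi> a s z *\<^sub>v Y z) $ i) (at z)"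
    if "z \<noteq> 0" "i < 2" for z i
    using Y that by (auto simp: is_vector_polynomial_solution_def is_solution_def)
  have "poly_system l \<chi> a s p q"
    unfolding poly_system_iff_ode
  proof (intro allI impI)
    fix z :: complex assume z: "z \<noteq> 0"
    have "poly (pderiv p) z = (system_mat l \<chi> a s z *\<^sub>v Y z) $ 0"
      using D[OF z, of 0] by (intro DERIV_unique[OF poly_DERIV]) (simp add: p)
    moreover have "poly (pderiv q) z = (system_mat l \<chi> a s z *\<^sub>v Y z) $ 1"
      using D[OF z one_less_numeral_iff[THEN iffD2]]
      by (intro DERIV_unique[OF poly_DERIV]) (simp add: q[symmetric])
    ultimately show "poly (pderiv p) z = (- (s / 2) * poly p z - s * \<chi> * poly q z) / z^2
             + ((of_nat l - \<chi> * a) * poly p z - a / 2 * poly q z) / z \<and>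
        poly (pderiv q) z = (a / 2 * poly p z + \<chi> * a * poly q z) / z
             + s * \<chi> * poly p z + s / 2 * poly q z"
      by (simp only: system_mat_mult_vec[OF carr] p q)
  qed
  moreover have "p \<noteq> 0 \<or> q \<noteq> 0"
  proof (rule ccontr)
    assume "\<not> ?thesis"
    then have "Y z $ i = 0" if "i < 2" for z i
      using that p q by (auto simp: less_2_cases_iff)
    then have "Y z = 0\<^sub>v 2" for z
      using carr by (intro eq_vecI) auto
    then show False using Y by (simp add: is_vector_polynomial_solution_def)
  qed
  ultimately show "\<exists>p q. poly_system l \<chi> a s p q \<and> (p \<noteq> 0 \<or> q \<noteq> 0)" by blast
next
  assume "\<exists>p q. poly_system l \<chi> a s p q \<and> (p \<noteq> 0 \<or> q \<noteq> 0)"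
  then obtain p q where sys: "poly_system l \<chi> a s p q" and nz: "p \<noteq> 0 \<or> q \<noteq> 0" by blast
  define Y where "Y = (\<lambda>z. vec_of_list [poly p z, poly q z])"
  have carr: "Y z \<in> carrier_vec 2" and Y0: "Y z $ 0 = poly p z" and Y1: "Y z $ 1 = poly q z" for z
    by (auto simp: Y_def vec_of_list_index intro!: carrier_vecI)
  have "is_solution l \<chi> a s Y"
    unfolding is_solution_def
  proof (intro conjI allI impI carr)
    fix z :: complex and i :: nat assume z: "z \<noteq> 0" and i: "i < 2"
    have e: "poly (pderiv p) z = (system_mat l \<chi> a s z *\<^sub>v Y z) $ 0"
      "poly (pderiv q) z = (system_mat l \<chi> a s z *\<^sub>v Y z) $ 1"
      using sys z unfolding poly_system_iff_ode system_mat_mult_vec[OF carr] Y0 Y1 by blast+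
    show "((\<lambda>w. Y w $ i) has_field_derivative (system_mat l \<chi> a s z *\<^sub>v Y z) $ i) (at z)"
    proof (cases "i = 0")
      case True
      then show ?thesis by (simp only: Y0 e(1)[symmetric] poly_DERIV)
    next
      case False
      then have "i = 1" using i by simp
      then show ?thesis by (simp only: Y1 e(2)[symmetric] poly_DERIV)
    qed
  qed
  moreover have "\<exists>z. Y z \<noteq> 0\<^sub>v 2"
  proof (rule ccontr)
    assume "\<not> ?thesis"
    then have "Y z $ 0 = 0" "Y z $ 1 = 0" for z by simp_all
    then have "\<forall>z. poly p z = 0" "\<forall>z. poly q z = 0" by (simp_all only: Y0 Y1) simp_all
    with nz show False by (simp only: poly_all_0_iff_0) simp
  qed
  moreover have "\<forall>i<2. \<exists>p. \<forall>z. Y z $ i = poly p z"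
    using Y0 Y1 by (metis less_2_cases_iff One_nat_def)
  ultimately show "\<exists>Y. is_vector_polynomial_solution l \<chi> a s Y"
    unfolding is_vector_polynomial_solution_def by blast
qed

section \<open>Coefficient recurrences and the degree bound\<close>

text \<open>Comparison of constant terms and of the coefficients of \<open>z^(k+1)\<close> in both
  rows. The two constant-term conditions are \<open>s\<close> and \<open>a\<close> times the same
  expression \<open>coeff p 0 / 2 + \<chi> * coeff q 0\<close>. Putting \<open>l - Suc k\<close> for
  \<open>k\<close> in the first recurrence, when \<open>k < l\<close>, and exchanging
  \<open>coeff p i\<close> with \<open>coeff q (l - i)\<close> gives the second.\<close>

lemma poly_system_iff_coeff:
  "poly_system l \<chi> a s p q \<longleftrightarrow>
     (s / 2 * coeff p 0 + s * \<chi> * coeff q 0 = 0 \<and> a / 2 * coeff p 0 + \<chi> * a * coeff q 0 = 0) \<and>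
     (\<forall>k. s / 2 * coeff p (Suc k) + (\<chi> * a + of_nat k - of_nat l) * coeff p k
            + s * \<chi> * coeff q (Suc k) + a / 2 * coeff q k = 0) \<and>
     (\<forall>k. s / 2 * coeff q k + (\<chi> * a - of_nat (Suc k)) * coeff q (Suc k)
            + a / 2 * coeff p (Suc k) + s * \<chi> * coeff p k = 0)"
proof -
  have all_nat: "(\<forall>k. P k) \<longleftrightarrow> P 0 \<and> (\<forall>k. P (Suc k))" for P :: "nat \<Rightarrow> bool"
    by (metis not0_implies_Suc)
  have shift: "coeff (pCons 0 (pderiv r)) k = of_nat k * coeff r k" for r :: "complex poly" and k
    by (cases k) (auto simp: coeff_pderiv)
  \<comment> \<open>The first row is normalised as left minus right side, the second as right minus
    left, hence the disjunction.\<close>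
  have move: "x = y \<longleftrightarrow> u = 0" if "u = x - y \<or> u = y - x" for x y u :: complex
    using that by auto
  let ?lhs1 = "pCons 0 (pCons 0 (pderiv p))" and ?lhs2 = "pCons 0 (pderiv q)"
  let ?rhs1 = "pCons 0 (smult (of_nat l - \<chi> * a) p - smult (a / 2) q) - smult (s / 2) p - smult (s * \<chi>) q"
  let ?rhs2 = "pCons 0 (smult (s * \<chi>) p + smult (s / 2) q) + smult (a / 2) p + smult (\<chi> * a) q"
  have "coeff ?lhs1 0 = coeff ?rhs1 0 \<longleftrightarrow> s / 2 * coeff p 0 + s * \<chi> * coeff q 0 = 0"
    by (rule move) simp
  moreover have "coeff ?lhs1 (Suc k) = coeff ?rhs1 (Suc k) \<longleftrightarrow>
      s / 2 * coeff p (Suc k) + (\<chi> * a + of_nat k - of_nat l) * coeff p k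
            + s * \<chi> * coeff q (Suc k) + a / 2 * coeff q k = 0" for k
    by (rule move) (simp only: coeff_pCons_Suc shift coeff_diff coeff_smult, simp add: algebra_simps)
  moreover have "coeff ?lhs2 0 = coeff ?rhs2 0 \<longleftrightarrow> a / 2 * coeff p 0 + \<chi> * a * coeff q 0 = 0"
    by (rule move) simp
  moreover have "coeff ?lhs2 (Suc k) = coeff ?rhs2 (Suc k) \<longleftrightarrow>
      s / 2 * coeff q k + (\<chi> * a - of_nat (Suc k)) * coeff q (Suc k)
            + a / 2 * coeff p (Suc k) + s * \<chi> * coeff p k = 0" for k
    by (rule move) (simp only: coeff_pCons_Suc coeff_pderiv coeff_add coeff_smult, simp add: algebra_simps)
  ultimately show ?thesis
    unfolding poly_system_def poly_eq_iff by (subst (1 2) all_nat) auto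
qed

text \<open>At \<open>k = d\<close>, the larger of the two degrees, all coefficients with index
  \<open>Suc d\<close> drop out. The second recurrence, after division by \<open>s\<close>, ties
  \<open>coeff q d\<close> to \<open>coeff p d\<close>. In the first one this makes the terms with
  \<open>\<chi> * a\<close> cancel and leaves \<open>(d - l) * coeff p d = 0\<close>.\<close>

lemma degree_le_of_poly_system:
  assumes "poly_system l \<chi> a s p q" "s \<noteq> 0"
  shows "degree p \<le> l" "degree q \<le> l"
proof -
  note E = assms(1)[unfolded poly_system_iff_coeff]
  define d where "d = max (degree p) (degree q)"
  have top: "coeff p (Suc d) = 0" "coeff q (Suc d) = 0"
    by (auto simp: d_def intro!: coeff_eq_0)
  have "s * (coeff q d / 2 + \<chi> * coeff p d) = 0"
    using E top by (metis (no_types, lifting) add.right_neutral mult_zero_right ring_class.ring_distribs(1) mult.assoc times_divide_eq_left times_divide_eq_right)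
  then have "coeff q d / 2 + \<chi> * coeff p d = 0"
    using assms(2) by simp
  moreover have "coeff q d = 2 * (coeff q d / 2 + \<chi> * coeff p d) - 2 * \<chi> * coeff p d"
    by simp
  ultimately have q: "coeff q d = - 2 * \<chi> * coeff p d" by simp
  have "(\<chi> * a + of_nat d - of_nat l) * coeff p d + a / 2 * coeff q d = 0"
    using E top by (metis (no_types, lifting) add.right_neutral add.left_neutral mult_zero_right)
  then have "(of_nat d - of_nat l) * coeff p d = 0"
    unfolding q by (simp add: algebra_simps)
  then have "d = l \<or> (coeff p d = 0 \<and> coeff q d = 0)"
    by (auto simp: q)
  \<comment> \<open>The polynomial whose degree is \<open>d\<close> then has leading coefficient 0,
    so it is the zero polynomial and has degree 0.\<close>
  moreover have "d = 0" if "coeff p d = 0" "coeff q d = 0"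
    using that by (metis d_def degree_0 leading_coeff_0_iff max_def)
  ultimately have "d \<le> l" by auto
  then show "degree p \<le> l" "degree q \<le> l" by (auto simp: d_def)
qed

section \<open>Reflection symmetry and kernel vectors\<close>

text \<open>Row \<open>i < l\<close> is the second recurrence at \<open>i\<close> plus
  \<open>\<sigma>\<close> times the first one at \<open>l - Suc i\<close>. Since
  \<open>\<sigma> * \<sigma> = 1\<close>, the coefficients of \<open>p\<close> and \<open>q\<close>
  occur in this sum only in the combinations that make up the vector.\<close>

lemma kernel_eqs_of_poly_system:
  assumes "poly_system l \<chi> a s p q" "s \<noteq> 0" "\<sigma> * \<sigma> = 1"
  shows "kernel_eqs \<sigma> l \<chi> a s (\<lambda>i. coeff q i + \<sigma> * coeff p (l - i))"
  unfolding kernel_eqs_def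
proof (intro conjI allI impI)
  note E = assms(1)[unfolded poly_system_iff_coeff]
  have \<sigma>: "\<sigma> * (\<sigma> * x) = x" for x
    using assms(3) by (simp add: mult.assoc[symmetric])
  {
    fix i assume "i < l"
    then obtain k where l: "l = Suc (i + k)" using less_iff_Suc_add by auto
    have e1: "s / 2 * coeff p (Suc k) + (\<chi> * a + of_nat k - of_nat l) * coeff p k
            + s * \<chi> * coeff q (Suc k) + a / 2 * coeff q k = 0"
     and e2: "s / 2 * coeff q i + (\<chi> * a - of_nat (Suc i)) * coeff q (Suc i)
            + a / 2 * coeff p (Suc i) + s * \<chi> * coeff p i = 0"
      using E by blast+
    have ix: "l - i = Suc k" "l - Suc i = k" "l - k = Suc i" "l - Suc k = i"
      using l by auto
    have c: "\<chi> * a + of_nat k - of_nat l = \<chi> * a - of_nat (Suc i)" by (simp add: l)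
    show "s / 2 * (coeff q i + \<sigma> * coeff p (l - i))
        + (\<chi> * a - of_nat (Suc i)) * (coeff q (Suc i) + \<sigma> * coeff p (l - Suc i))
        + \<sigma> * (a / 2 * (coeff q (l - Suc i) + \<sigma> * coeff p (l - (l - Suc i)))
        + \<chi> * s * (coeff q (l - i) + \<sigma> * coeff p (l - (l - i)))) = 0" (is "?L = 0")
    proof -
      have "?L = (s / 2 * coeff q i + (\<chi> * a - of_nat (Suc i)) * coeff q (Suc i)
            + a / 2 * coeff p (Suc i) + s * \<chi> * coeff p i)
          + \<sigma> * (s / 2 * coeff p (Suc k) + (\<chi> * a + of_nat k - of_nat l) * coeff p k
            + s * \<chi> * coeff q (Suc k) + a / 2 * coeff q k)"
        unfolding ix c by (simp add: distrib_left distrib_right \<sigma> mult_ac del: of_nat_Suc)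
      then show ?thesis unfolding e1 e2 by simp
    qed
  }
  \<comment> \<open>For the last row, the degree bound reduces the second recurrence at
    \<open>k = l\<close> to two terms. This and the constant term of the first row are both
    divisible by \<open>s\<close>; the row is the first quotient plus \<open>\<sigma>\<close> times
    the second.\<close>
  have "coeff p (Suc l) = 0" "coeff q (Suc l) = 0"
    using degree_le_of_poly_system[OF assms(1,2)] by (auto intro!: coeff_eq_0)
  then have "s / 2 * coeff q l + s * \<chi> * coeff p l = 0"
    using E by (metis (no_types, lifting) add.right_neutral mult_zero_right)
  then have "s * (coeff q l / 2 + \<chi> * coeff p l) = 0" by (simp add: algebra_simps)
  moreover have "s * (coeff p 0 / 2 + \<chi> * coeff q 0) = 0" using E by (simp add: algebra_simps)
  ultimately have f: "coeff q l / 2 + \<chi> * coeff p l = 0" "coeff p 0 / 2 + \<chi> * coeff q 0 = 0"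
    using assms(2) by simp_all
  have "(coeff q l + \<sigma> * coeff p (l - l)) / 2 + \<sigma> * \<chi> * (coeff q 0 + \<sigma> * coeff p (l - 0))
     = (coeff q l / 2 + \<chi> * coeff p l) + \<sigma> * (coeff p 0 / 2 + \<chi> * coeff q 0)"
    by (simp add: algebra_simps add_divide_distrib \<sigma>)
  then show "(coeff q l + \<sigma> * coeff p (l - l)) / 2 + \<sigma> * \<chi> * (coeff q 0 + \<sigma> * coeff p (l - 0)) = 0"
    unfolding f by simp
qed

text \<open>Here \<open>p\<close> is \<open>\<sigma>\<close> times the reversal of \<open>q\<close>,
  so both recurrences come from the same rows: for \<open>k < l\<close> the second is row
  \<open>k\<close>, and the first is \<open>\<sigma>\<close> times row \<open>l - Suc k\<close>. The
  last row covers \<open>k = l\<close> and the constant terms.\<close>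

lemma poly_system_of_kernel_eqs:
  assumes ker: "kernel_eqs \<sigma> l \<chi> a s v" and \<sigma>: "\<sigma> * \<sigma> = 1"
    and p: "\<And>k. coeff p k = (if k \<le> l then \<sigma> * v (l - k) else 0)"
    and q: "\<And>k. coeff q k = (if k \<le> l then v k else 0)"
  shows "poly_system l \<chi> a s p q"
proof -
  have \<sigma>2: "\<sigma> * (\<sigma> * x) = x" for x
    using \<sigma> by (simp add: mult.assoc[symmetric])
  have row: "s / 2 * v i + (\<chi> * a - of_nat (Suc i)) * v (Suc i)
            + \<sigma> * (a / 2 * v (l - Suc i) + \<chi> * s * v (l - i)) = 0" if "i < l" for i
    using ker that by (auto simp: kernel_eqs_def)
  have last: "v l / 2 + \<sigma> * \<chi> * v 0 = 0"
    using ker by (auto simp: kernel_eqs_def)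
  have last': "v l = - 2 * \<sigma> * \<chi> * v 0"
    using last by (simp add: field_simps add_eq_0_iff)
  have E1: "s / 2 * coeff p (Suc k) + (\<chi> * a + of_nat k - of_nat l) * coeff p k
            + s * \<chi> * coeff q (Suc k) + a / 2 * coeff q k = 0" for k
  proof (cases k l rule: linorder_cases)
    case less
    then obtain i where l: "l = Suc (k + i)" using less_iff_Suc_add by auto
    have c: "\<chi> * a + of_nat k - of_nat l = \<chi> * a - of_nat (Suc i)" by (simp add: l)
    have ix: "l - i = Suc k" "l - Suc i = k" "l - k = Suc i" "l - Suc k = i" "k \<le> l" "Suc k \<le> l"
      using l by auto
    have "i < l" using l by simp
    have "s / 2 * coeff p (Suc k) + (\<chi> * a + of_nat k - of_nat l) * coeff p k
            + s * \<chi> * coeff q (Suc k) + a / 2 * coeff q k =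
          \<sigma> * (s / 2 * v i + (\<chi> * a - of_nat (Suc i)) * v (Suc i)
            + \<sigma> * (a / 2 * v (l - Suc i) + \<chi> * s * v (l - i)))"
      unfolding c p q by (simp add: ix distrib_left distrib_right \<sigma>2 mult_ac del: of_nat_Suc)
    then show ?thesis using row[OF \<open>i < l\<close>] by simp
  next
    case equal
    \<comment> \<open>The factor \<open>of_nat k - of_nat l\<close> vanishes, and what remains is
      \<open>a\<close> times the last row.\<close>
    then show ?thesis by (simp add: p q last' algebra_simps)
  next
    case greater
    then show ?thesis by (simp add: p q)
  qed
  have E2: "s / 2 * coeff q k + (\<chi> * a - of_nat (Suc k)) * coeff q (Suc k)
            + a / 2 * coeff p (Suc k) + s * \<chi> * coeff p k = 0" for k
  proof (cases k l rule: linorder_cases)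
    case less
    then show ?thesis using row[OF less]
      by (simp add: p q distrib_left mult_ac add_ac del: of_nat_Suc)
  next
    case equal
    then show ?thesis by (simp add: p q last' algebra_simps)
  next
    case greater
    then show ?thesis by (simp add: p q)
  qed
  show ?thesis
    \<comment> \<open>For the constant terms, \<open>last'\<close> and
      \<open>\<sigma> * \<sigma> = 1\<close> give
      \<open>coeff p 0 = - 2 * \<chi> * coeff q 0\<close>.\<close>
    unfolding poly_system_iff_coeff using E1 E2 by (simp add: p q last' \<sigma>2 algebra_simps)
qed

text \<open>A nonzero solution may have one vanishing symmetry part but not both, so a nonzero
  kernel vector exists for at least one sign. Conversely, a kernel vector supplies the coefficients
  of \<open>q\<close> directly, so \<open>q\<close> is nonzero.\<close>

lemma ex_poly_system_iff:
  assumes "s \<noteq> 0"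
  shows "(\<exists>p q. poly_system l \<chi> a s p q \<and> (p \<noteq> 0 \<or> q \<noteq> 0)) \<longleftrightarrow>
    (\<exists>\<sigma>\<in>{1, -1}. \<exists>v. kernel_eqs \<sigma> l \<chi> a s v \<and> (\<exists>i\<le>l. v i \<noteq> 0))"
proof
  assume "\<exists>p q. poly_system l \<chi> a s p q \<and> (p \<noteq> 0 \<or> q \<noteq> 0)"
  then obtain p q where sys: "poly_system l \<chi> a s p q" and nz: "p \<noteq> 0 \<or> q \<noteq> 0" by blast
  note deg = degree_le_of_poly_system[OF sys assms]
  show "\<exists>\<sigma>\<in>{1, -1}. \<exists>v. kernel_eqs \<sigma> l \<chi> a s v \<and> (\<exists>i\<le>l. v i \<noteq> 0)"
  proof (rule ccontr)
    assume neg: "\<not> ?thesis"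
    have z: "coeff q i + \<sigma> * coeff p (l - i) = 0" if "\<sigma> \<in> {1, -1}" "i \<le> l" for \<sigma> i
      using neg kernel_eqs_of_poly_system[OF sys assms, of \<sigma>] that by force
    \<comment> \<open>Adding and subtracting the relations for the two signs separates
      \<open>q\<close> from \<open>p\<close>.\<close>
    have pq: "coeff q i = 0" "coeff p (l - i) = 0" if "i \<le> l" for i
      using z[of 1 i] z[of "-1" i] that by auto
    have "coeff q i = 0" for i
      using pq(1)[of i] deg(2) by (cases "i \<le> l") (auto intro: coeff_eq_0)
    moreover have "coeff p i = 0" for i
      using pq(2)[of "l - i"] deg(1) by (cases "i \<le> l") (auto intro: coeff_eq_0)
    ultimately show False using nz by (auto simp: poly_eq_iff)
  qed
next
  assume "\<exists>\<sigma>\<in>{1, -1}. \<exists>v. kernel_eqs \<sigma> l \<chi> a s v \<and> (\<exists>i\<le>l. v i \<noteq> 0)"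
  then obtain \<sigma> v i where v: "\<sigma> * \<sigma> = 1" "kernel_eqs \<sigma> l \<chi> a s v" "i \<le> l" "v i \<noteq> 0"
    by (metis insertE mult.right_neutral mult_minus1_right minus_minus singletonD)
  define p where "p = (\<Sum>k\<le>l. monom (\<sigma> * v (l - k)) k)"
  define q where "q = (\<Sum>k\<le>l. monom (v k) k)"
  have p: "coeff p k = (if k \<le> l then \<sigma> * v (l - k) else 0)"
    and q: "coeff q k = (if k \<le> l then v k else 0)" for k
    by (auto simp: p_def q_def coeff_sum sum.delta)
  have "poly_system l \<chi> a s p q"
    using poly_system_of_kernel_eqs[OF v(2,1) p q] .
  moreover have "q \<noteq> 0" using q[of i] v(3,4) by auto
  ultimately show "\<exists>p q. poly_system l \<chi> a s p q \<and> (p \<noteq> 0 \<or> q \<noteq> 0)" by blast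
qed

section \<open>Kernel equations and determinants\<close>

lemma G1_mult_vec:
  assumes "v \<in> carrier_vec (l + 1)" "i \<le> l"
  shows "(G1 l \<chi> a s *\<^sub>v v) $ i =
    (if i < l then s / 2 * v $ i + (\<chi> * a - of_nat (Suc i)) * v $ Suc i else v $ l / 2)"
proof -
  have "(G1 l \<chi> a s *\<^sub>v v) $ i = (\<Sum>j<l+1. G1_entry l \<chi> a s (Suc i) (Suc j) * v $ j)"
    using assms by (simp add: G1_def scalar_prod_def atLeast0LessThan)
  also have "\<dots> = (\<Sum>j<l+1. if i < l then (if j = i then s / 2 * v $ j else 0)
       + (if j = Suc i then (\<chi> * a - of_nat (Suc i)) * v $ j else 0) else if j = l then v $ j / 2 else 0)"
    using assms by (intro sum.cong) (auto simp: G1_entry_def)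
  also have "\<dots> = (if i < l then s / 2 * v $ i + (\<chi> * a - of_nat (Suc i)) * v $ Suc i else v $ l / 2)"
    using assms by (auto simp: sum.distrib sum.delta simp del: of_nat_Suc sum.lessThan_Suc)
  finally show ?thesis .
qed

lemma G2_mult_vec:
  assumes "v \<in> carrier_vec (l + 1)" "i \<le> l"
  shows "(G2 l \<chi> a s *\<^sub>v v) $ i =
    (if i < l then a / 2 * v $ (l - Suc i) + \<chi> * s * v $ (l - i) else \<chi> * v $ 0)"
proof -
  have "(G2 l \<chi> a s *\<^sub>v v) $ i = (\<Sum>j<l+1. G2_entry l \<chi> a s (Suc i) (Suc j) * v $ j)"
    using assms by (simp add: G2_def scalar_prod_def atLeast0LessThan)
  \<comment> \<open>With 0-based indices, columns \<open>l + 1 - j\<close> and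
    \<open>l + 2 - j\<close> of row \<open>j = Suc i\<close> become \<open>l - Suc i\<close> and
    \<open>l - i\<close>. For \<open>i < l\<close> they are distinct, so the nested conditional
    splits into a sum.\<close>
  also have "\<dots> = (\<Sum>j<l+1. if i < l then (if j = l - Suc i then a / 2 * v $ j else 0)
       + (if j = l - i then \<chi> * s * v $ j else 0) else if j = 0 then \<chi> * v $ j else 0)"
    using assms by (intro sum.cong) (auto simp: G2_entry_def)
  also have "\<dots> = (if i < l then a / 2 * v $ (l - Suc i) + \<chi> * s * v $ (l - i) else \<chi> * v $ 0)"
    using assms by (auto simp: sum.distrib sum.delta simp del: sum.lessThan_Suc)
  finally show ?thesis .
qed

text \<open>Over a field a square matrix is singular exactly when it kills a nonzero vector; vectors
  of dimension \<open>l + 1\<close> are matched with functions restricted to indices up to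
  \<open>l\<close>.\<close>

lemma det_eq_0_iff_kernel_eqs:
  "det (G1 l \<chi> a s + \<sigma> \<cdot>\<^sub>m G2 l \<chi> a s) = 0 \<longleftrightarrow>
     (\<exists>v. kernel_eqs \<sigma> l \<chi> a s v \<and> (\<exists>i\<le>l. v i \<noteq> 0))"
proof -
  let ?A = "G1 l \<chi> a s + \<sigma> \<cdot>\<^sub>m G2 l \<chi> a s"
  have G: "G1 l \<chi> a s \<in> carrier_mat (l + 1) (l + 1)" "G2 l \<chi> a s \<in> carrier_mat (l + 1) (l + 1)"
    by (auto simp: G1_def G2_def)
  then have A: "?A \<in> carrier_mat (l + 1) (l + 1)" by auto
  have ker: "?A *\<^sub>v w = 0\<^sub>v (l + 1) \<longleftrightarrow> kernel_eqs \<sigma> l \<chi> a s (($) w)"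
    if w: "w \<in> carrier_vec (l + 1)" for w
  proof -
    have rows: "row (G1 l \<chi> a s) i \<in> carrier_vec (l + 1)" "row (G2 l \<chi> a s) i \<in> carrier_vec (l + 1)" for i
      by (auto simp: G1_def G2_def intro!: carrier_vecI)
    have "(?A *\<^sub>v w) $ i = (G1 l \<chi> a s *\<^sub>v w) $ i + \<sigma> * (G2 l \<chi> a s *\<^sub>v w) $ i" if "i \<le> l" for i
      using G w that rows add_scalar_prod_distrib[of "row (G1 l \<chi> a s) i" "l + 1"
          "\<sigma> \<cdot>\<^sub>v row (G2 l \<chi> a s) i" w] by simp
    moreover have "?A *\<^sub>v w = 0\<^sub>v (l + 1) \<longleftrightarrow> (\<forall>i<l. (?A *\<^sub>v w) $ i = 0) \<and> (?A *\<^sub>v w) $ l = 0"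
      using A by (auto simp: vec_eq_iff less_Suc_eq simp del: index_mult_mat_vec)
    ultimately show ?thesis
      using w by (simp add: kernel_eqs_def G1_mult_vec G2_mult_vec mult.assoc
          del: of_nat_Suc index_mult_mat_vec)
  qed
  have "det ?A = 0 \<longleftrightarrow> (\<exists>w. w \<in> carrier_vec (l + 1) \<and> w \<noteq> 0\<^sub>v (l + 1) \<and> ?A *\<^sub>v w = 0\<^sub>v (l + 1))"
    by (rule det_0_iff_vec_prod_zero[OF A])
  also have "\<dots> \<longleftrightarrow> (\<exists>v. kernel_eqs \<sigma> l \<chi> a s v \<and> (\<exists>i\<le>l. v i \<noteq> 0))"
  proof
    assume "\<exists>w. w \<in> carrier_vec (l + 1) \<and> w \<noteq> 0\<^sub>v (l + 1) \<and> ?A *\<^sub>v w = 0\<^sub>v (l + 1)"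
    then obtain w where "w \<in> carrier_vec (l + 1)" "w \<noteq> 0\<^sub>v (l + 1)" "kernel_eqs \<sigma> l \<chi> a s (($) w)"
      using ker by blast
    then show "\<exists>v. kernel_eqs \<sigma> l \<chi> a s v \<and> (\<exists>i\<le>l. v i \<noteq> 0)"
      by (intro exI[of _ "($) w"]) (auto simp: vec_eq_iff less_Suc_eq_le)
  next
    assume "\<exists>v. kernel_eqs \<sigma> l \<chi> a s v \<and> (\<exists>i\<le>l. v i \<noteq> 0)"
    then obtain v i where v: "kernel_eqs \<sigma> l \<chi> a s v" and i: "i \<le> l" "v i \<noteq> 0" by blast
    \<comment> \<open>Every index occurring in \<open>kernel_eqs\<close> is at most
      \<open>l\<close>, so truncating \<open>v\<close> to a vector changes nothing.\<close>
    have "kernel_eqs \<sigma> l \<chi> a s (($) (vec (l + 1) v))"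
      using v by (simp add: kernel_eqs_def)
    moreover have "vec (l + 1) v \<noteq> 0\<^sub>v (l + 1)"
      using i by (auto simp: vec_eq_iff less_Suc_eq_le)
    ultimately show "\<exists>w. w \<in> carrier_vec (l + 1) \<and> w \<noteq> 0\<^sub>v (l + 1) \<and> ?A *\<^sub>v w = 0\<^sub>v (l + 1)"
      using ker[of "vec (l + 1) v"] by (metis vec_carrier)
  qed
  finally show ?thesis .
qed

theorem theorem1p12:
  fixes l :: nat and \<chi> a s :: complex
  assumes "l \<ge> 1" and "s \<noteq> 0"
  shows "(\<exists>Y. is_vector_polynomial_solution l \<chi> a s Y) \<longleftrightarrow>
           (P_plus l \<chi> a s = 0 \<or> P_minus l \<chi> a s = 0)"
proof -
  \<comment> \<open>Both signs are written as scalar multiples, so that one determinant criterion,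
    with \<open>\<sigma>\<close> equal to 1 or -1, serves both.\<close>
  have "G1 l \<chi> a s + 1 \<cdot>\<^sub>m G2 l \<chi> a s = G1 l \<chi> a s + G2 l \<chi> a s"
    "G1 l \<chi> a s + (-1) \<cdot>\<^sub>m G2 l \<chi> a s = G1 l \<chi> a s - G2 l \<chi> a s"
    by (auto intro!: eq_matI simp: G1_def G2_def)
  then have "P_plus l \<chi> a s = det (G1 l \<chi> a s + 1 \<cdot>\<^sub>m G2 l \<chi> a s)"
    "P_minus l \<chi> a s = det (G1 l \<chi> a s + (-1) \<cdot>\<^sub>m G2 l \<chi> a s)"
    by (simp_all only: P_plus_def P_minus_def)
  then show ?thesis
    by (simp only: det_eq_0_iff_kernel_eqs ex_vector_polynomial_solution_iff
        ex_poly_system_iff[OF assms(2)] bex_simps, simp)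
qed

end
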